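(* Let $x>2$ and $y$ be integers with $y>(2x^2+2x+1)/(x-2)$. Then there exists $V$ such that for every integer $v\ge V$ with $v\equiv\pm1\pmod{xy}$, every multiset of size $v-1$ with support $\{1,x,y\}$ is realizable.
   Context: $K_v$ is the complete graph on vertex set $\{0,\dots,v-1\}$; the length of an edge $\{u,w\}$ is $\min(|u-w|,v-|u-w|)$. A multiset $L$ of size $v-1$ is realizable if some Hamiltonian path in $K_v$ has multiset of edge lengths equal to $L$. The support of a multiset is its set of distinct elements. (The paper phrases this as the Buratti–Horak–Rosa Conjecture holding for such $L$; for $v\equiv\pm1\pmod{xy}$ its divisibility condition is vacuous.) *)

theory Defs
  imports Complex_Main "HOL-Library.Multiset" "HOL-Number_Theory.Cong"
begin

definition complete_graph_verts :: "int \<Rightarrow> int set" where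
  "complete_graph_verts v = {0..v - 1}"

definition complete_graph_edges :: "int \<Rightarrow> int set set" where
  "complete_graph_edges v =
     {{u, w} | u w. u \<in> complete_graph_verts v \<and> w \<in> complete_graph_verts v \<and> u \<noteq> w}"

(* The pairs of consecutive vertices of the vertex sequence p are zip p (tl p). *)
definition hamiltonian_path :: "'a set \<Rightarrow> 'a set set \<Rightarrow> 'a list \<Rightarrow> bool" where
  "hamiltonian_path V E p \<longleftrightarrow>
     distinct p \<and> set p = V \<and> (\<forall>(u, w) \<in> set (zip p (tl p)). {u, w} \<in> E)"

definition edge_length :: "int \<Rightarrow> int \<Rightarrow> int \<Rightarrow> int" where
  "edge_length v u w = min \<bar>u - w\<bar> (v - \<bar>u - w\<bar>)"

definition edge_lengths :: "int \<Rightarrow> int list \<Rightarrow> int multiset" where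
  "edge_lengths v p = image_mset (\<lambda>(u, w). edge_length v u w) (mset (zip p (tl p)))"

(* The order v of the complete graph is kept explicit; for v >= 1 an L that is
   realizable in this sense has size v - 1. *)
definition realizable :: "int \<Rightarrow> int multiset \<Rightarrow> bool" where
  "realizable v L \<longleftrightarrow>
     (\<exists>p. hamiltonian_path (complete_graph_verts v) (complete_graph_edges v) p
        \<and> edge_lengths v p = L)"

end

theory Submission
  imports Defs
begin

text \<open>
  Two facts are combined. First, if \<open>a > x + y\<close> and \<open>x, y \<le> v / 2\<close>, then
  \<open>{1^a, x^b, y^c}\<close> is realized by a path of the integer interval \<open>{0..<v}\<close> with these absolute
  differences: for one step size \<open>x\<close> the residue classes modulo \<open>x\<close> are columns traversed one
  after the other, which costs at most \<open>x\<close> steps of length 1 and starts at an end of the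
  interval, and the paths for \<open>x\<close> and \<open>y\<close> are glued at those ends. Second, multiplication by a
  unit modulo \<open>v\<close> permutes the vertices. For \<open>v = m x y \<plusminus> 1\<close> the list is therefore equivalent to
  \<open>{1^c, (m x)^a, (m x^2)^b}\<close> and to \<open>{1^b, (m y)^a, z^c}\<close> with \<open>z \<equiv> \<plusminus>m y^2\<close> and \<open>z \<le> v / 2\<close>. If the
  first fact applies to neither the list itself nor the first of these, then
  \<open>a \<le> x + y\<close> and \<open>c \<le> m x + m x^2\<close>, so \<open>b\<close> exceeds \<open>m y + z\<close> for large \<open>m\<close>, because
  \<open>(x - 2) y > 2 x^2 + 2 x\<close>.
\<close>

section \<open>Paths on sets of integers\<close>

text \<open>\<open>ham M S s e\<close>: some path from \<open>s\<close> to \<open>e\<close> visits every element of \<open>S\<close> exactly once, and \<open>M\<close>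
  is its multiset of absolute differences.\<close>

inductive ham :: "int multiset \<Rightarrow> int set \<Rightarrow> int \<Rightarrow> int \<Rightarrow> bool" where
  single: "ham {#} {s} s s"
| step: "ham M S u e \<Longrightarrow> s \<notin> S \<Longrightarrow> ham (add_mset \<bar>s - u\<bar> M) (insert s S) s e"

lemma ham_append:
  assumes "ham M S s e" "ham M' S' s' e'" "S \<inter> S' = {}"
  shows "ham (add_mset \<bar>e - s'\<bar> (M + M')) (S \<union> S') s e'"
  using assms
proof (induction rule: ham.induct)
  case (single s)
  then show ?case using ham.step[of M' S' s' e' s] by simp
next
  case (step M S u e s)
  then have "ham (add_mset \<bar>e - s'\<bar> (M + M')) (S \<union> S') u e'" "s \<notin> S \<union> S'" by auto
  from ham.step[OF this] show ?case by (simp add: add_mset_commute)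
qed

text \<open>\<open>ham_append\<close> with joining length, multiset and vertex set constrained by
  equations, so that each gluing can be stated in its target form and leaves these equations as
  goals.\<close>

lemma ham_join:
  assumes "ham M S s e" "ham M' S' s' e'" "\<bar>e - s'\<bar> = d" "S \<inter> S' = {}"
    and "N = add_mset d (M + M')" "T = S \<union> S'"
  shows "ham N T s e'"
  using ham_append assms by blast

lemma ham_rev: "ham M S s e \<Longrightarrow> ham M S e s"
proof (induction rule: ham.induct)
  case (single s)
  show ?case by (rule ham.single)
next
  case (step M S u e s)
  from ham_append[OF step.IH ham.single[of s]] step.hyps
  show ?case by (simp add: abs_minus_commute)
qed

text \<open>A distance-preserving map is injective, so it carries paths to paths with the same
  differences. It serves for translations and reflections.\<close>

lemma ham_isometry:
  assumes "ham M S s e" "\<And>u w. \<bar>f u - f w\<bar> = \<bar>u - w\<bar>"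
  shows "ham M (f ` S) (f s) (f e)"
  using assms(1)
proof (induction rule: ham.induct)
  case (single s)
  show ?case using ham.single by simp
next
  case (step M S u e s)
  have "inj f" using assms(2) by (metis abs_eq_0 eq_iff_diff_eq_0 injI)
  then have "f s \<notin> f ` S" using step.hyps by (auto dest: injD)
  from ham.step[OF step.IH this] show ?case by (simp add: assms(2))
qed

lemma ham_list:
  assumes "ham M S s e"
  obtains p where "distinct p" "set p = S"
    "image_mset (\<lambda>(u, w). \<bar>u - w\<bar>) (mset (zip p (tl p))) = M"
proof -
  \<comment> \<open>Nonemptiness and the head are carried along so that prepending \<open>s\<close>
    adds exactly the pair of \<open>s\<close> and \<open>u\<close>.\<close>
  from assms have "\<exists>p. distinct p \<and> set p = S \<and> p \<noteq> [] \<and> hd p = s \<and>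
    image_mset (\<lambda>(u, w). \<bar>u - w\<bar>) (mset (zip p (tl p))) = M"
  proof (induction rule: ham.induct)
    case (single s)
    show ?case by (rule exI[of _ "[s]"]) simp
  next
    case (step M S u e s)
    then obtain p where p: "distinct p" "set p = S" "p \<noteq> []" "hd p = u"
      "image_mset (\<lambda>(u, w). \<bar>u - w\<bar>) (mset (zip p (tl p))) = M" by blast
    then obtain p' where "p = u # p'" by (cases p) auto
    with p step.hyps show ?case by (intro exI[of _ "s # p"]) auto
  qed
  with that show thesis by blast
qed

section \<open>Traversing residue classes\<close>

text \<open>The numbers with residue in \<open>I\<close> modulo \<open>x\<close> are drawn as columns with rows \<open>0, \<dots>, h\<close>.\<close>

definition grid :: "nat \<Rightarrow> int set \<Rightarrow> nat \<Rightarrow> int set" where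
  "grid x I h = {n. 0 \<le> n \<and> n mod int x \<in> I \<and> n div int x \<le> int h}"

lemma grid_disjoint: "I \<inter> J = {} \<Longrightarrow> grid x I h \<inter> grid x J k = {}"
  by (auto simp: grid_def)

lemma grid_Un: "grid x (I \<union> J) h = grid x I h \<union> grid x J h"
  by (auto simp: grid_def)

lemma cell_mod_div:
  assumes "0 \<le> c" "c < int x"
  shows "(c + int x * j) mod int x = c" "(c + int x * j) div int x = j"
  using assms by (auto simp: mod_pos_pos_trivial div_pos_pos_trivial)

lemma grid_singleton_0:
  assumes "0 \<le> c" "c < int x"
  shows "grid x {c} 0 = {c}"
proof (intro equalityI subsetI)
  fix n assume n: "n \<in> grid x {c} 0"
  then have "n div int x = 0" using assms pos_imp_zdiv_nonneg_iff[of "int x" n]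
    by (simp add: grid_def)
  with n show "n \<in> {c}" using div_mult_mod_eq[of n "int x"] by (simp add: grid_def)
qed (use assms in \<open>simp add: grid_def\<close>)

lemma grid_singleton_Suc:
  assumes "0 \<le> c" "c < int x"
  shows "grid x {c} (Suc h) = insert (c + int x * int (Suc h)) (grid x {c} h)"
proof (intro set_eqI iffI)
  fix n assume n: "n \<in> grid x {c} (Suc h)"
  show "n \<in> insert (c + int x * int (Suc h)) (grid x {c} h)"
  proof (cases "n div int x = int (Suc h)")
    case True
    with n have "n = c + int x * int (Suc h)"
      using mult_div_mod_eq[of "int x" n] unfolding grid_def True by simp
    then show ?thesis by simp
  next
    case False
    with n show ?thesis by (auto simp: grid_def)
  qed
next
  fix n assume n: "n \<in> insert (c + int x * int (Suc h)) (grid x {c} h)"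
  have "(c + int x * int (Suc h)) mod int x = c" "(c + int x * int (Suc h)) div int x = int (Suc h)"
    using assms by (auto simp del: of_nat_Suc)
  with n assms show "n \<in> grid x {c} (Suc h)" by (auto simp: grid_def)
qed

lemma grid_notin: "int h < n div int x \<Longrightarrow> n \<notin> grid x I h"
  by (auto simp: grid_def)

text \<open>With \<open>n = x * q + m\<close>, an interval consists of full rows
  \<open>0, ..., h\<close> and the first \<open>r\<close> cells of row \<open>h + 1\<close>: the
  columns below \<open>r\<close> are one cell taller than the others.\<close>

lemma grid_all:
  assumes "0 \<le> r" "r \<le> int x" "0 < x"
  shows "grid x {0..<r} (Suc h) \<union> grid x {r..<int x} h = {0..<int x * int h + int x + r}"
proof (intro set_eqI)
  fix n :: int
  define q m where "q = n div int x" and "m = n mod int x"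
  have n: "n = int x * q + m" and m: "0 \<le> m" "m < int x"
    using assms unfolding q_def m_def by auto
  have lhs: "n \<in> grid x {0..<r} (Suc h) \<union> grid x {r..<int x} h \<longleftrightarrow>
      0 \<le> n \<and> (m < r \<and> q \<le> int h + 1 \<or> r \<le> m \<and> q \<le> int h)"
    using m by (auto simp: grid_def q_def m_def)
  consider "q \<le> int h" | "q = int h + 1" | "int h + 2 \<le> q" by linarith
  then have "(m < r \<and> q \<le> int h + 1 \<or> r \<le> m \<and> q \<le> int h) \<longleftrightarrow> n < int x * int h + int x + r"
  proof cases
    case 1
    have "n < int x * int h + int x + r"
      using mult_left_mono[OF 1, of "int x"] n m assms by linarith
    with 1 show ?thesis by linarith
  next
    case 2
    then have "n = int x * int h + int x + m" using n by (simp add: algebra_simps)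
    with 2 show ?thesis by linarith
  next
    case 3
    have "int x * (int h + 2) = int x * int h + 2 * int x" by (simp add: algebra_simps)
    then have "\<not> n < int x * int h + int x + r"
      using mult_left_mono[OF 3, of "int x"] n m assms by linarith
    with 3 show ?thesis by linarith
  qed
  with lhs show "n \<in> grid x {0..<r} (Suc h) \<union> grid x {r..<int x} h \<longleftrightarrow>
      n \<in> {0..<int x * int h + int x + r}" by simp
qed

section \<open>Snakes through consecutive columns\<close>

lemma ham_column:
  assumes "0 \<le> c" "c < int x"
  shows "ham (replicate_mset h (int x)) (grid x {c} h) c (c + int x * int h)"
proof (induction h)
  case 0
  show ?case using ham.single[of c] grid_singleton_0[OF assms] by simp
next
  case (Suc h)
  show ?case
  proof (rule ham_join[OF Suc ham.single[of "c + int x * int (Suc h)"]])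
    show "\<bar>c + int x * int h - (c + int x * int (Suc h))\<bar> = int x" by (simp add: algebra_simps)
    have "(c + int x * int (Suc h)) div int x = int (Suc h)"
      using assms by (auto simp del: of_nat_Suc)
    then show "grid x {c} h \<inter> {c + int x * int (Suc h)} = {}"
      by (auto simp: grid_def simp del: of_nat_Suc)
  qed (use grid_singleton_Suc[OF assms] in auto)
qed

text \<open>Columns are traversed alternately upwards and downwards, with a step of length 1 along
  the top or bottom row in between. For even \<open>k\<close> the number \<open>k + 1\<close> of
  columns is odd, so the last one is climbed; otherwise the path ends in row 0.\<close>

lemma ham_snake:
  assumes "0 \<le> c" "c + int k < int x"
  shows "ham (replicate_mset k 1 + replicate_mset (Suc k * h) (int x)) (grid x {c..c + int k} h)
           c (c + int k + (if even k then int x * int h else 0))"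
  using assms
proof (induction k)
  case 0
  then show ?case using ham_column[of c x h] by simp
next
  case (Suc k)
  define d where "d = c + int (Suc k)"
  have d: "0 \<le> d" "d < int x" using Suc.prems by (auto simp: d_def)
  have col: "ham (replicate_mset h (int x)) (grid x {d} h)
      (d + (if even k then int x * int h else 0)) (d + (if even (Suc k) then int x * int h else 0))"
    using ham_column[OF d, of h] ham_rev by auto
  have I: "grid x {c..d} h = grid x {c..c + int k} h \<union> grid x {d} h"
    unfolding grid_Un[symmetric] by (rule arg_cong[where f = "\<lambda>I. grid x I h"])
      (use Suc.prems in \<open>auto simp: d_def\<close>)
  show ?case unfolding d_def[symmetric]
  proof (rule ham_join[OF Suc.IH col _ _ _ I])
    show "grid x {c..c + int k} h \<inter> grid x {d} h = {}"
      by (rule grid_disjoint) (auto simp: d_def)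
  qed (use Suc.prems in \<open>auto simp: d_def multiset_eq_iff\<close>)
qed

text \<open>The half-turn \<open>f\<close> of the block of columns sends column \<open>m\<close>,
  row \<open>q\<close> to column \<open>2 * c + k - m\<close>, row \<open>h - q\<close>, and so
  turns the snake from the bottom left into one from the top right.\<close>

lemma ham_snake_down:
  assumes "0 \<le> c" "c + int k < int x"
  shows "ham (replicate_mset k 1 + replicate_mset (Suc k * h) (int x)) (grid x {c..c + int k} h)
           (c + int k + int x * int h) (c + (if even k then 0 else int x * int h))"
proof -
  define f where "f n = (2 * c + int k) + int x * int h - n" for n
  have f_grid: "f n \<in> grid x {c..c + int k} h" if n: "n \<in> grid x {c..c + int k} h" for n
  proof -
    define q m where "q = n div int x" and "m = n mod int x"
    have "n = int x * q + m" using assms unfolding q_def m_def by simp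
    then have f: "f n = (2 * c + int k - m) + int x * (int h - q)"
      unfolding f_def by (simp add: algebra_simps)
    have qm: "0 \<le> q" "q \<le> int h" "c \<le> m" "m \<le> c + int k"
      using n assms unfolding grid_def q_def m_def by (auto simp: pos_imp_zdiv_nonneg_iff)
    then have "f n mod int x = 2 * c + int k - m" "f n div int x = int h - q"
      unfolding f using assms by (auto intro!: cell_mod_div)
    moreover have "0 \<le> f n" unfolding f using qm assms by simp
    ultimately show ?thesis using qm by (simp add: grid_def)
  qed
  \<comment> \<open>As \<open>f\<close> is an involution, mapping the block into itself already
    gives equality.\<close>
  have "f ` grid x {c..c + int k} h = grid x {c..c + int k} h"
  proof (intro equalityI subsetI)
    fix n assume "n \<in> grid x {c..c + int k} h"
    from f_grid[OF this] show "n \<in> f ` grid x {c..c + int k} h"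
      by (rule rev_image_eqI) (simp add: f_def)
  qed (use f_grid in blast)
  moreover have "f c = c + int k + int x * int h"
    "f (c + int k + (if even k then int x * int h else 0)) = c + (if even k then 0 else int x * int h)"
    by (simp_all add: f_def)
  moreover have "\<bar>f u - f w\<bar> = \<bar>u - w\<bar>" for u w by (simp add: f_def)
  ultimately show ?thesis using ham_isometry[OF ham_snake[OF assms, of h], of f] by metis
qed

text \<open>Enter the last two columns at the top of the left one, go down the right one and back up the
  left one: one extra step of length 1 buys the parity that a snake cannot achieve.\<close>

lemma ham_hook:
  assumes "x = k + 2"
  shows "\<exists>e. ham (replicate_mset 2 1 + replicate_mset (2 * h + 1) (int x))
           (grid x {int k..<int x} (Suc h)) (int k + int x * int (Suc h)) e"
proof -
  define K where "K = int k"
  define T where "T = K + int x * int (Suc h)"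
  have K: "0 \<le> K" "K < int x" "0 \<le> K + 1" "K + 1 < int x" and I: "{K..<int x} = {K} \<union> {K + 1}"
    using assms by (auto simp: K_def)
  have T: "T mod int x = K" "T div int x = int (Suc h)"
    unfolding T_def by (rule cell_mod_div[OF K(1,2)])+
  have 1: "ham (replicate_mset 1 1 + replicate_mset (Suc h) (int x))
      ({T} \<union> grid x {K + 1} (Suc h)) T (K + 1)"
  proof (rule ham_join[OF ham.single ham_rev[OF ham_column[OF K(3,4)]], where d = 1])
    show "{T} \<inter> grid x {K + 1} (Suc h) = {}" using T by (simp add: grid_def)
  qed (simp_all add: T_def)
  have S: "grid x {K..<int x} (Suc h) = {T} \<union> grid x {K + 1} (Suc h) \<union> grid x {K} h"
    unfolding I grid_Un grid_singleton_Suc[OF K(1,2)] T_def by blast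
  have "ham (replicate_mset 2 1 + replicate_mset (2 * h + 1) (int x))
           (grid x {K..<int x} (Suc h)) T (K + int x * int h)"
  proof (rule ham_join[OF 1 ham_column[OF K(1,2), of h] _ _ _ S])
    have "T \<notin> grid x {K} h" using T by (simp add: grid_notin)
    moreover have "grid x {K + 1} (Suc h) \<inter> grid x {K} h = {}" by (rule grid_disjoint) simp
    ultimately show "({T} \<union> grid x {K + 1} (Suc h)) \<inter> grid x {K} h = {}" by blast
    show "\<bar>K + 1 - K\<bar> = 1" by simp
    show "replicate_mset 2 1 + replicate_mset (2 * h + 1) (int x) =
      add_mset 1 (replicate_mset 1 1 + replicate_mset (Suc h) (int x) + replicate_mset h (int x))"
      by (simp add: multiset_eq_iff)
  qed
  then show ?thesis unfolding K_def T_def by blast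
qed

section \<open>Paths of an interval from its left end with step sizes 1 and x\<close>

text \<open>An even number \<open>r > 0\<close> of taller columns brings the snake back to row 0,
  from where a second snake takes the lower columns; the difference in height does not interfere.
  For \<open>r = 0\<close> one snake suffices.\<close>

lemma ham_from_0_even:
  assumes "0 < x" "even r" "r < x"
  shows "\<exists>e. ham (replicate_mset (x - 1) 1 + replicate_mset (x * h + r) (int x))
           {0..<int x * int h + int x + int r} 0 e"
proof (cases "r = 0")
  case True
  have I: "{0..0 + int (x - 1)} = {0..<int x}" using assms by auto
  have "grid x {0..0 + int (x - 1)} h = {0..<int x * int h + int x + int r}"
    unfolding I using grid_all[of 0 x h] assms True by (simp add: grid_def)
  moreover have "Suc (x - 1) = x" using assms by simp
  ultimately have "ham (replicate_mset (x - 1) 1 + replicate_mset (x * h) (int x))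
      {0..<int x * int h + int x + int r} 0
      (0 + int (x - 1) + (if even (x - 1) then int x * int h else 0))"
    using ham_snake[of 0 "x - 1" x h] assms by simp
  then show ?thesis unfolding True by auto
next
  case False
  then obtain k where k: "r = Suc k" "odd k" using assms by (cases r) auto
  obtain l where l: "x = k + l + 2" using k less_imp_Suc_add[OF assms(3)] by auto
  have I: "{0..<int r} = {0..0 + int k}" "{int r..<int x} = {int r..int r + int l}"
    using k l by auto
  have S: "{0..<int x * int h + int x + int r} =
      grid x {0..0 + int k} (Suc h) \<union> grid x {int r..int r + int l} h"
    using grid_all[of "int r" x h] assms unfolding I by simp
  have "ham (replicate_mset k 1 + replicate_mset (Suc k * Suc h) (int x)) (grid x {0..0 + int k} (Suc h)) 0 (int k)"
    using ham_snake[of 0 k x "Suc h"] k l by simp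
  moreover have "ham (replicate_mset l 1 + replicate_mset (Suc l * h) (int x)) (grid x {int r..int r + int l} h) (int r)
      (int r + int l + (if even l then int x * int h else 0))"
    using ham_snake[of "int r" l x h] k l by simp
  ultimately have "ham (replicate_mset (x - 1) 1 + replicate_mset (x * h + r) (int x))
           {0..<int x * int h + int x + int r} 0 (int r + int l + (if even l then int x * int h else 0))"
  proof (rule ham_join[OF _ _ _ _ _ S])
    show "\<bar>int k - int r\<bar> = 1" using k by simp
    show "grid x {0..0 + int k} (Suc h) \<inter> grid x {int r..int r + int l} h = {}"
      by (rule grid_disjoint) (use k in auto)
    have "x * h + r = Suc k * Suc h + Suc l * h" "x - 1 = Suc (k + l)"
      by (simp_all add: k l algebra_simps)
    then show "replicate_mset (x - 1) 1 + replicate_mset (x * h + r) (int x) = add_mset 1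
     (replicate_mset k 1 + replicate_mset (Suc k * Suc h) (int x) +
      (replicate_mset l 1 + replicate_mset (Suc l * h) (int x)))"
      by (simp add: multiset_eq_iff)
  qed
  then show ?thesis ..
qed

text \<open>After column 0 the path turns back from the top cell \<open>x * (h + 1)\<close> of that column to the top
  cell \<open>x * (h + 1) - 1\<close> of column \<open>x - 1\<close>, and visits the columns in descending order.\<close>

lemma ham_from_0_odd_descending:
  assumes "odd r" "r < x" "even x \<or> h = 0"
  shows "\<exists>e. ham (replicate_mset (x - 1) 1 + replicate_mset (x * h + r) (int x))
           {0..<int x * int h + int x + int r} 0 e"
proof -
  obtain l where l: "x = r + l + 1" using assms
    by (metis add.commute add_Suc_right less_imp_Suc_add plus_1_eq_Suc)
  have r: "r > 0" using assms by (cases r) auto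
  have 1: "ham (replicate_mset (Suc h) (int x)) (grid x {0} (Suc h)) 0 (int x * int (Suc h))"
    using ham_column[of 0 x "Suc h"] l by simp
  have 2: "ham (replicate_mset l 1 + replicate_mset (Suc l * h) (int x))
      (grid x {int r..<int x} h) (int x - 1 + int x * int h) (int r)"
  proof -
    have *: "int r + int l + int x * int h = int x - 1 + int x * int h"
      "{int r..int r + int l} = {int r..<int x}" using l by auto
    \<comment> \<open>If \<open>x\<close> is even, then so is \<open>l = x - r - 1\<close>, and the
      odd number \<open>l + 1\<close> of columns ends at the bottom; if \<open>h = 0\<close>, top
      and bottom coincide.\<close>
    have "(if even l then 0 else int x * int h) = 0" using assms l by auto
    then show ?thesis using ham_snake_down[of "int r" l x h] l unfolding * by simp
  qed
  define M where "M = replicate_mset (Suc l) 1 + replicate_mset (Suc h + Suc l * h) (int x)"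
  have 3: "ham M (grid x {0} (Suc h) \<union> grid x {int r..<int x} h) 0 (int r)"
  proof (rule ham_join[OF 1 2, where d = 1])
    show "grid x {0} (Suc h) \<inter> grid x {int r..<int x} h = {}"
      by (rule grid_disjoint) (use r in auto)
    show "\<bar>int x * int (Suc h) - (int x - 1 + int x * int h)\<bar> = 1" by (simp add: algebra_simps)
  qed (simp_all add: M_def multiset_eq_iff)
  show ?thesis
  proof (cases "r = 1")
    case True
    have I: "{0..<1::int} = {0}" by auto
    have "grid x {0} (Suc h) \<union> grid x {int r..<int x} h = {0..<int x * int h + int x + int r}"
      using grid_all[of 1 x h] True assms I by simp
    moreover have "M = replicate_mset (x - 1) 1 + replicate_mset (x * h + r) (int x)"
      using True by (simp add: M_def l)
    ultimately show ?thesis using 3 by auto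
  next
    case False
    then obtain k where k: "r = Suc (Suc k)" using r by (metis One_nat_def gr0_implies_Suc neq0_conv)
    have kb: "1 + int k < int x" "odd k" using assms k l by auto
    have *: "1 + int k = int r - 1" "{1..int r - 1} = {1..<int r}" using k by auto
    have "ham (replicate_mset k 1 + replicate_mset (Suc k * Suc h) (int x))
        (grid x {1..<int r} (Suc h)) 1 (int r - 1)"
      using ham_snake[of 1 k x "Suc h"] kb unfolding * by simp
    \<comment> \<open>Columns \<open>1, ..., r - 1\<close> are even in number, so their snake has
      both ends in row 0; reversed, it starts next to the bottom of column \<open>r\<close>.\<close>
    then have 4: "ham (replicate_mset k 1 + replicate_mset (Suc k * Suc h) (int x))
        (grid x {1..<int r} (Suc h)) (int r - 1) 1"
      by (rule ham_rev)
    have I: "{0..<int r} = {0} \<union> {1..<int r}" using r by auto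
    have S: "{0..<int x * int h + int x + int r} =
        grid x {0} (Suc h) \<union> grid x {int r..<int x} h \<union> grid x {1..<int r} (Suc h)"
      using grid_all[of "int r" x h] assms unfolding I grid_Un by (simp add: Un_ac)
    have "ham (replicate_mset (x - 1) 1 + replicate_mset (x * h + r) (int x))
           {0..<int x * int h + int x + int r} 0 1"
    proof (rule ham_join[OF 3 4 _ _ _ S])
      have "grid x {0} (Suc h) \<inter> grid x {1..<int r} (Suc h) = {}"
        "grid x {int r..<int x} h \<inter> grid x {1..<int r} (Suc h) = {}"
        by (rule grid_disjoint; use r in auto)+
      then show "(grid x {0} (Suc h) \<union> grid x {int r..<int x} h) \<inter> grid x {1..<int r} (Suc h) = {}"
        by blast
      show "\<bar>int r - (int r - 1)\<bar> = 1" by simp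
      have "x * h + r = Suc h + Suc l * h + Suc k * Suc h" "x - 1 = Suc (Suc l + k)"
        by (simp_all add: k l algebra_simps)
      then show "replicate_mset (x - 1) 1 + replicate_mset (x * h + r) (int x) =
          add_mset 1 (M + (replicate_mset k 1 + replicate_mset (Suc k * Suc h) (int x)))"
        by (simp add: M_def multiset_eq_iff)
    qed
    then show ?thesis ..
  qed
qed

text \<open>One more unit step than in the other parities gives \<open>r + 1\<close> taller columns,
  an even number. If \<open>r < x - 2\<close>, their snake returns to row 0, the odd number of
  columns from \<open>r + 1\<close> to \<open>x - 3\<close> then leads to the top, and the hook
  finishes the last two columns from there.\<close>

lemma ham_from_0_odd_hook:
  assumes "odd x" "odd r" "r < x"
  shows "\<exists>e. ham (replicate_mset x 1 + replicate_mset (x * Suc h + r) (int x))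
           {0..<int x * int (Suc h) + int x + int r + 1} 0 e"
proof -
  have "r + 2 \<le> x" using assms by presburger
  then obtain k where k: "x = k + 2" "r \<le> k" using le_Suc_ex[of 2 x] by (auto simp: add.commute)
  have odd_k: "odd k" using assms k by simp
  obtain e where hook: "ham (replicate_mset 2 1 + replicate_mset (2 * h + 1) (int x))
      (grid x {int k..<int x} (Suc h)) (int k + int x * int (Suc h)) e"
    using ham_hook[OF k(1)] by blast
  have all: "{0..<int x * int (Suc h) + int x + int r + 1} =
      grid x {0..<int r + 1} (Suc (Suc h)) \<union> grid x {int r + 1..<int x} (Suc h)"
    using grid_all[of "int r + 1" x "Suc h"] k by (simp add: add.assoc)
  show ?thesis
  proof (cases "r = k")
    case True
    then obtain l where l: "k = Suc l" "even l" using odd_k by (cases k) auto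
    \<comment> \<open>Column \<open>k\<close> is now itself taller. The snake through the
      \<open>k\<close> columns before it, an odd number, ends in the top row; the path takes the
      surplus cell \<open>T\<close> and drops by \<open>x\<close> to the start of the hook.\<close>
    define T where "T = int k + int x * int (Suc (Suc h))"
    have T: "T mod int x = int k" "T div int x = int (Suc (Suc h))"
      unfolding T_def by (rule cell_mod_div; use k in simp)+
    have I: "{0..0 + int l} = {0..<int k}" using l by auto
    have 1: "ham (replicate_mset l 1 + replicate_mset (Suc l * Suc (Suc h)) (int x))
        (grid x {0..<int k} (Suc (Suc h))) 0 (int l + int x * int (Suc (Suc h)))"
    proof -
      have "0 + int l < int x" using k l by simp
      then show ?thesis using ham_snake[of 0 l x "Suc (Suc h)"] l(2) unfolding I by simp
    qed
    define M where "M = replicate_mset (Suc l) 1 + replicate_mset (Suc l * Suc (Suc h)) (int x)"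
    have 2: "ham M (grid x {0..<int k} (Suc (Suc h)) \<union> {T}) 0 T"
    proof (rule ham_join[OF 1 ham.single, where d = 1])
      show "\<bar>int l + int x * int (Suc (Suc h)) - T\<bar> = 1" using l by (simp add: T_def)
      show "grid x {0..<int k} (Suc (Suc h)) \<inter> {T} = {}" using T by (simp add: grid_def)
    qed (simp_all add: M_def)
    have I2: "{0..<int r + 1} = {0..<int k} \<union> {int k}" "{int k..<int x} = {int k} \<union> {int r + 1..<int x}"
      using True k by auto
    have kT: "grid x {int k} (Suc (Suc h)) = insert T (grid x {int k} (Suc h))"
      unfolding T_def by (rule grid_singleton_Suc) (use k in auto)
    have S: "{0..<int x * int (Suc h) + int x + int r + 1} =
        grid x {0..<int k} (Suc (Suc h)) \<union> {T} \<union> grid x {int k..<int x} (Suc h)"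
      unfolding all I2 grid_Un kT by blast
    have "ham (replicate_mset x 1 + replicate_mset (x * Suc h + r) (int x))
       {0..<int x * int (Suc h) + int x + int r + 1} 0 e"
    proof (rule ham_join[OF 2 hook _ _ _ S])
      have "grid x {0..<int k} (Suc (Suc h)) \<inter> grid x {int k..<int x} (Suc h) = {}"
        by (rule grid_disjoint) auto
      moreover have "T \<notin> grid x {int k..<int x} (Suc h)" using T by (simp add: grid_notin)
      ultimately show "(grid x {0..<int k} (Suc (Suc h)) \<union> {T}) \<inter> grid x {int k..<int x} (Suc h) = {}"
        by blast
      show "\<bar>T - (int k + int x * int (Suc h))\<bar> = int x" by (simp add: T_def algebra_simps)
      have "x * Suc h + r = Suc (Suc l * Suc (Suc h) + (2 * h + 1))" "x = Suc l + 2"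
        by (simp_all add: k True l algebra_simps)
      then show "replicate_mset x 1 + replicate_mset (x * Suc h + r) (int x) =
          add_mset (int x) (M + (replicate_mset 2 1 + replicate_mset (2 * h + 1) (int x)))"
        by (simp add: M_def multiset_eq_iff)
    qed
    then show ?thesis ..
  next
    case False
    then have "r + 2 \<le> k" using k odd_k assms by presburger
    then obtain l where l: "k = r + 2 + l" using le_Suc_ex by blast
    have even_l: "even l" using l odd_k assms by simp
    have I1: "{0..0 + int r} = {0..<int r + 1}" by auto
    have I2: "{int r + 1..int r + 1 + int l} = {int r + 1..<int k}" using l by auto
    have 1: "ham (replicate_mset r 1 + replicate_mset (Suc r * Suc (Suc h)) (int x))
        (grid x {0..<int r + 1} (Suc (Suc h))) 0 (int r)"
    proof -
      have "0 + int r < int x" using assms by simp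
      then show ?thesis using ham_snake[of 0 r x "Suc (Suc h)"] assms(2) unfolding I1 by simp
    qed
    have 2: "ham (replicate_mset l 1 + replicate_mset (Suc l * Suc h) (int x))
        (grid x {int r + 1..<int k} (Suc h)) (int r + 1) (int r + 1 + int l + int x * int (Suc h))"
    proof -
      have "int r + 1 + int l < int x" using k l by simp
      then show ?thesis using ham_snake[of "int r + 1" l x "Suc h"] even_l unfolding I2 by simp
    qed
    define M where "M = replicate_mset (Suc (r + l)) 1 +
      replicate_mset (Suc r * Suc (Suc h) + Suc l * Suc h) (int x)"
    have 3: "ham M (grid x {0..<int r + 1} (Suc (Suc h)) \<union> grid x {int r + 1..<int k} (Suc h)) 0
        (int r + 1 + int l + int x * int (Suc h))"
    proof (rule ham_join[OF 1 2, where d = 1])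
      show "grid x {0..<int r + 1} (Suc (Suc h)) \<inter> grid x {int r + 1..<int k} (Suc h) = {}"
        by (rule grid_disjoint) auto
    qed (simp_all add: M_def multiset_eq_iff)
    have I3: "{int r + 1..<int x} = {int r + 1..<int k} \<union> {int k..<int x}" using k l by auto
    have S: "{0..<int x * int (Suc h) + int x + int r + 1} =
        grid x {0..<int r + 1} (Suc (Suc h)) \<union> grid x {int r + 1..<int k} (Suc h) \<union>
        grid x {int k..<int x} (Suc h)"
      unfolding all I3 grid_Un by blast
    have "ham (replicate_mset x 1 + replicate_mset (x * Suc h + r) (int x))
       {0..<int x * int (Suc h) + int x + int r + 1} 0 e"
    proof (rule ham_join[OF 3 hook _ _ _ S])
      have "grid x {0..<int r + 1} (Suc (Suc h)) \<inter> grid x {int k..<int x} (Suc h) = {}"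
        "grid x {int r + 1..<int k} (Suc h) \<inter> grid x {int k..<int x} (Suc h) = {}"
        by (rule grid_disjoint; use l in auto)+
      then show "(grid x {0..<int r + 1} (Suc (Suc h)) \<union> grid x {int r + 1..<int k} (Suc h)) \<inter>
          grid x {int k..<int x} (Suc h) = {}" by blast
      show "\<bar>int r + 1 + int l + int x * int (Suc h) - (int k + int x * int (Suc h))\<bar> = 1"
        using l by simp
      have "x * Suc h + r = Suc r * Suc (Suc h) + Suc l * Suc h + (2 * h + 1)"
        "x = Suc (Suc (r + l)) + 2"
        by (simp_all add: k l algebra_simps)
      then show "replicate_mset x 1 + replicate_mset (x * Suc h + r) (int x) =
          add_mset 1 (M + (replicate_mset 2 1 + replicate_mset (2 * h + 1) (int x)))"
        by (simp add: M_def multiset_eq_iff)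
    qed
    then show ?thesis ..
  qed
qed

section \<open>Surplus unit steps and a second step size\<close>

lemma ham_shift:
  assumes "ham M {a..<b} s e"
  shows "ham M {a + d..<b + d} (s + d) (e + d)"
proof -
  have "(\<lambda>n. n + d) ` {a..<b} = {a + d..<b + d}" by simp
  then show ?thesis using ham_isometry[OF assms, of "\<lambda>n. n + d"] by simp
qed

text \<open>Shifting a path up by one frees the vertex 0, which becomes the new start at distance 1
  from the old one.\<close>

lemma ham_prepend_ones:
  assumes "ham M {0..<n} 0 e"
  shows "\<exists>e. ham (replicate_mset j 1 + M) {0..<n + int j} 0 e"
proof (induction j)
  case 0
  show ?case using assms by auto
next
  case (Suc j)
  then obtain e where e: "ham (replicate_mset j 1 + M) {0..<n + int j} 0 e" by blast
  have "0 \<in> {0..<n}" using assms by cases auto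
  then have "insert 0 {0 + 1..<n + int j + 1} = {0..<n + int (Suc j)}" by auto
  with ham.step[OF ham_shift[OF e, of 1], of 0] show ?case by auto
qed

text \<open>With \<open>b = x * h + r\<close>, every parity case is settled by \<open>x - 1\<close>
  or \<open>x\<close> unit steps, the latter only for \<open>x\<close>, \<open>r\<close> odd and
  \<open>h\<close> nonzero. The remaining unit steps are prepended.\<close>

lemma ham_from_0:
  assumes "0 < x" "x \<le> a"
  shows "\<exists>e. ham (replicate_mset a 1 + replicate_mset b (int x)) {0..<int a + int b + 1} 0 e"
proof -
  define h r where "h = b div x" and "r = b mod x"
  have b: "b = x * h + r" and r: "r < x" using assms by (simp_all add: h_def r_def)
  have "\<exists>a0 \<le> x. \<exists>e. ham (replicate_mset a0 1 + replicate_mset b (int x)) {0..<int a0 + int b + 1} 0 e"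
  proof (cases "odd r \<and> odd x \<and> h \<noteq> 0")
    case True
    then obtain g where g: "h = Suc g" using not0_implies_Suc by blast
    have "\<exists>e. ham (replicate_mset x 1 + replicate_mset (x * Suc g + r) (int x))
        {0..<int x * int (Suc g) + int x + int r + 1} 0 e"
      by (rule ham_from_0_odd_hook) (use True r in auto)
    moreover have "int x * int (Suc g) + int x + int r + 1 = int x + int b + 1" "x * Suc g + r = b"
      by (simp_all add: b g algebra_simps)
    ultimately have "\<exists>e. ham (replicate_mset x 1 + replicate_mset b (int x)) {0..<int x + int b + 1} 0 e"
      by (simp only:)
    then show ?thesis by blast
  next
    case False
    have "int (x - 1) + int b + 1 = int x * int h + int x + int r"
      using assms by (simp add: b)
    moreover have "\<exists>e. ham (replicate_mset (x - 1) 1 + replicate_mset (x * h + r) (int x))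
        {0..<int x * int h + int x + int r} 0 e"
      using False ham_from_0_even[OF assms(1) _ r] ham_from_0_odd_descending[OF _ r] by blast
    ultimately show ?thesis unfolding b[symmetric] by (intro exI[of _ "x - 1"]) auto
  qed
  then obtain a0 e where "a0 \<le> x" and
    e: "ham (replicate_mset a0 1 + replicate_mset b (int x)) {0..<int a0 + int b + 1} 0 e" by blast
  then obtain j where a: "a = j + a0" using assms by (metis add.commute le_Suc_ex le_trans)
  have "replicate_mset j 1 + (replicate_mset a0 1 + replicate_mset b (int x)) =
      replicate_mset a 1 + replicate_mset b (int x)"
    "int a0 + int b + 1 + int j = int a + int b + 1"
    by (simp_all add: a multiset_eq_iff)
  with ham_prepend_ones[OF e, of j] show ?thesis by simp
qed

text \<open>The unit steps are split into \<open>x\<close> for step size \<open>x\<close>, one for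
  the joint, and \<open>a' \<ge> y\<close> for step size \<open>y\<close>. Reflecting the first path
  at \<open>K\<close> puts its end 0 at \<open>K\<close>, next to the shifted start
  \<open>K + 1\<close> of the second.\<close>

lemma ham_1_x_y:
  assumes "0 < x" "0 < y" "x + y + 1 \<le> a"
  shows "\<exists>s e. ham (replicate_mset a 1 + replicate_mset b (int x) + replicate_mset c (int y))
           {0..<int a + int b + int c + 1} s e"
proof -
  obtain a' where a: "a = x + a' + 1" and a': "y \<le> a'"
    using assms(3) by (metis add.commute add.left_commute add_le_cancel_left le_Suc_ex le_add1)
  obtain e where e: "ham (replicate_mset x 1 + replicate_mset b (int x)) {0..<int x + int b + 1} 0 e"
    using ham_from_0[OF assms(1)] by blast
  obtain e' where e': "ham (replicate_mset a' 1 + replicate_mset c (int y)) {0..<int a' + int c + 1} 0 e'"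
    using ham_from_0[OF assms(2) a'] by blast
  define K where "K = int x + int b"
  have "(\<lambda>n. K - n) ` {0..<int x + int b + 1} = {0..<K + 1}"
    by (auto simp: K_def image_iff intro!: bexI[of _ "K - _"])
  with ham_rev[OF ham_isometry[OF e, of "\<lambda>n. K - n"]]
  have 1: "ham (replicate_mset x 1 + replicate_mset b (int x)) {0..<K + 1} (K - e) K" by simp
  have 2: "ham (replicate_mset a' 1 + replicate_mset c (int y))
      {0 + (K + 1)..<int a' + int c + 1 + (K + 1)} (0 + (K + 1)) (e' + (K + 1))"
    by (rule ham_shift[OF e'])
  show ?thesis
  proof (intro exI, rule ham_join[OF 1 2, where d = 1])
    show "{0..<int a + int b + int c + 1} = {0..<K + 1} \<union> {0 + (K + 1)..<int a' + int c + 1 + (K + 1)}"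
      by (auto simp: a K_def)
    show "replicate_mset a 1 + replicate_mset b (int x) + replicate_mset c (int y) =
      add_mset 1 (replicate_mset x 1 + replicate_mset b (int x) +
        (replicate_mset a' 1 + replicate_mset c (int y)))"
      by (simp add: a multiset_eq_iff)
  qed auto
qed

section \<open>Multiplication by a unit modulo v\<close>

text \<open>The distance from \<open>d\<close> to the nearest multiple of \<open>v\<close>: edge
  length as an even function of the difference modulo \<open>v\<close>.\<close>

definition cyc_len :: "int \<Rightarrow> int \<Rightarrow> int" where
  "cyc_len v d = min (d mod v) (v - d mod v)"

lemma cyc_len_minus: "0 < v \<Longrightarrow> cyc_len v (- d) = cyc_len v d"
  by (simp add: cyc_len_def zmod_zminus1_eq_if min.commute)

lemma cyc_len_cong: "[d = d'] (mod v) \<Longrightarrow> cyc_len v d = cyc_len v d'"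
  by (simp add: cyc_len_def cong_def)

lemma cyc_len_cong_pm:
  "0 < v \<Longrightarrow> [d = d'] (mod v) \<or> [d = - d'] (mod v) \<Longrightarrow> cyc_len v d = cyc_len v d'"
  by (metis cyc_len_cong cyc_len_minus)

lemma cyc_len_small: "0 \<le> d \<Longrightarrow> 2 * d \<le> v \<Longrightarrow> cyc_len v d = d"
  by (cases "d = 0") (auto simp: cyc_len_def)

lemma cyc_len_bounds:
  assumes "0 < v"
  shows "0 \<le> cyc_len v d" "2 * cyc_len v d \<le> v"
    "[cyc_len v d = d] (mod v) \<or> [cyc_len v d = - d] (mod v)"
proof -
  have m: "0 \<le> d mod v" "d mod v < v" using assms by auto
  then show "0 \<le> cyc_len v d" "2 * cyc_len v d \<le> v"
    by (auto simp: cyc_len_def min_def)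
  have "cyc_len v d = d mod v \<or> cyc_len v d = v - d mod v"
    unfolding cyc_len_def by linarith
  moreover have "[v - d mod v = - d] (mod v)" by (simp add: cong_def mod_simps)
  ultimately show "[cyc_len v d = d] (mod v) \<or> [cyc_len v d = - d] (mod v)"
    by (auto simp: cong_def)
qed

section \<open>Edge lengths and realizability modulo v\<close>

lemma edge_length_eq_cyc_len:
  assumes "u \<in> {0..<v}" "w \<in> {0..<v}"
  shows "edge_length v u w = cyc_len v (u - w)"
proof (cases "w \<le> u")
  case True
  then show ?thesis using assms by (auto simp: cyc_len_def edge_length_def)
next
  case False
  then have "edge_length v u w = cyc_len v (w - u)" using assms by (auto simp: cyc_len_def edge_length_def)
  then show ?thesis using cyc_len_minus[of v "w - u"] assms by simp
qed

lemma zip_tl_mem: "(u, w) \<in> set (zip p (tl p)) \<Longrightarrow> u \<in> set p \<and> w \<in> set p"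
  by (cases p) (auto dest: set_zip_leftD set_zip_rightD)

lemma distinct_zip_tl: "distinct p \<Longrightarrow> (u, w) \<in> set (zip p (tl p)) \<Longrightarrow> u \<noteq> w"
  by (induction p rule: induct_list012) auto

text \<open>Consecutive entries of a list without repetitions differ, and any two distinct vertices
  span an edge.\<close>

lemma hamiltonian_path_complete_graph_iff:
  "hamiltonian_path (complete_graph_verts v) (complete_graph_edges v) p \<longleftrightarrow>
     distinct p \<and> set p = {0..<v}"
proof -
  have V: "complete_graph_verts v = {0..<v}" by (auto simp: complete_graph_verts_def)
  have "{u, w} \<in> complete_graph_edges v"
    if "distinct p" "set p = {0..<v}" "(u, w) \<in> set (zip p (tl p))" for u w
  proof -
    have "u \<in> {0..<v}" "w \<in> {0..<v}" "u \<noteq> w"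
      using zip_tl_mem[OF that(3)] distinct_zip_tl[OF that(1,3)] that(2) by auto
    then show ?thesis unfolding complete_graph_edges_def V by blast
  qed
  then show ?thesis unfolding hamiltonian_path_def V by blast
qed

lemma realizable_iff:
  "realizable v L \<longleftrightarrow> (\<exists>p. distinct p \<and> set p = {0..<v} \<and> edge_lengths v p = L)"
  by (simp add: realizable_def hamiltonian_path_complete_graph_iff)

text \<open>A unit \<open>s\<close> permutes the residues modulo \<open>v\<close>, so the image of a
  Hamiltonian path is one again, with all differences multiplied by \<open>s\<close>.\<close>

lemma realizable_multiply:
  assumes "0 < v" "coprime s v" "realizable v L"
  shows "realizable v (image_mset (\<lambda>d. cyc_len v (s * d)) L)"
proof -
  obtain p where p: "distinct p" "set p = {0..<v}" "edge_lengths v p = L"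
    using assms(3) unfolding realizable_iff by blast
  define f where "f u = s * u mod v" for u
  have inj: "inj_on f {0..<v}"
  proof (rule inj_onI)
    fix u w assume uw: "u \<in> {0..<v}" "w \<in> {0..<v}" "f u = f w"
    then have "[s * u = s * w] (mod v)" by (simp add: f_def cong_def)
    then have "[u = w] (mod v)" using assms(2) by (simp add: cong_mult_lcancel)
    with uw show "u = w" by (simp add: cong_def)
  qed
  moreover have "f ` {0..<v} \<subseteq> {0..<v}" using assms(1) by (auto simp: f_def)
  ultimately have surj: "f ` {0..<v} = {0..<v}" by (simp add: endo_inj_surj)
  have len: "edge_length v (f u) (f w) = cyc_len v (s * edge_length v u w)"
    if "u \<in> {0..<v}" "w \<in> {0..<v}" for u w
  proof -
    have "edge_length v (f u) (f w) = cyc_len v (f u - f w)"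
      using that surj by (intro edge_length_eq_cyc_len) blast+
    also have "\<dots> = cyc_len v (s * (u - w))"
      by (rule cyc_len_cong) (simp add: f_def cong_def mod_simps right_diff_distrib)
    also have "\<dots> = cyc_len v (s * edge_length v u w)"
    proof (rule cyc_len_cong_pm[OF assms(1)])
      \<comment> \<open>An edge length fixes the difference modulo \<open>v\<close> up to sign, and
        \<open>cyc_len\<close> ignores the sign.\<close>
      have "[u - w = edge_length v u w] (mod v) \<or> [u - w = - edge_length v u w] (mod v)"
        using cyc_len_bounds(3)[OF assms(1), of "u - w"] edge_length_eq_cyc_len[OF that]
        by (metis cong_minus_minus_iff cong_sym minus_minus)
      then show "[s * (u - w) = s * edge_length v u w] (mod v) \<or>
          [s * (u - w) = - (s * edge_length v u w)] (mod v)"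
        by (metis cong_scalar_left mult_minus_right)
    qed
    finally show ?thesis .
  qed
  have "edge_lengths v (map f p) = image_mset (\<lambda>d. cyc_len v (s * d)) (edge_lengths v p)"
  proof -
    have "zip (map f p) (tl (map f p)) = map (map_prod f f) (zip p (tl p))"
      by (simp add: map_tl[symmetric] zip_map_map map_prod_def case_prod_unfold)
    moreover have "edge_length v (f u) (f w) = cyc_len v (s * edge_length v u w)"
      if "(u, w) \<in> set (zip p (tl p))" for u w
      using len zip_tl_mem[OF that] p(2) by blast
    ultimately show ?thesis
      unfolding edge_lengths_def
      by (auto simp: image_mset.compositionality o_def intro!: image_mset_cong)
  qed
  moreover have "distinct (map f p)" "set (map f p) = {0..<v}"
    using p inj surj by (simp_all add: distinct_map)
  ultimately show ?thesis unfolding realizable_iff using p(3) by blast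
qed

text \<open>All differences of the interval path are at most \<open>v / 2\<close>, and up to that
  bound edge length and absolute difference agree.\<close>

lemma realizable_1_x_y:
  fixes v x y :: int
  assumes "0 < x" "0 < y" "2 * x \<le> v" "2 * y \<le> v" "x + y + 1 \<le> int a"
    and v: "v = int a + int b + int c + 1"
  shows "realizable v (replicate_mset a 1 + replicate_mset b x + replicate_mset c y)"
proof -
  let ?L = "replicate_mset a 1 + replicate_mset b x + replicate_mset c y"
  have "\<exists>s e. ham ?L {0..<v} s e"
    using ham_1_x_y[of "nat x" "nat y" a b c] assms by auto
  then obtain p where p: "distinct p" "set p = {0..<v}"
    "image_mset (\<lambda>(u, w). \<bar>u - w\<bar>) (mset (zip p (tl p))) = ?L"
    using ham_list by metis
  have "2 * d \<le> v" if "d \<in># ?L" for d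
    using that assms by (auto split: if_splits)
  then have "\<And>u w. (u, w) \<in> set (zip p (tl p)) \<Longrightarrow> 2 * \<bar>u - w\<bar> \<le> v"
    unfolding p(3)[symmetric] by force
  then have "edge_lengths v p = ?L"
    unfolding edge_lengths_def p(3)[symmetric] edge_length_def by (intro image_mset_cong) auto
  with p show ?thesis unfolding realizable_iff by blast
qed

section \<open>Orders congruent to plus or minus one\<close>

lemma realizable_multiply_1_x_y:
  assumes "realizable v (replicate_mset a 1 + replicate_mset b x + replicate_mset c y)"
    and "0 < v" "coprime s v"
    and "cyc_len v s = s'" "cyc_len v (s * x) = x'" "cyc_len v (s * y) = y'"
  shows "realizable v (replicate_mset a s' + replicate_mset b x' + replicate_mset c y')"
  using realizable_multiply[OF assms(2,3,1)] assms(4-6) by simp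

text \<open>\<open>(x - 2) * (2 * x)\<close> lies below the left side of the hypothesis; the
  positive factor \<open>x - 2\<close> cancels.\<close>

lemma two_x_less_y:
  fixes x y :: int
  assumes "2 < x" "2 * x * x + 2 * x + 2 \<le> (x - 2) * y"
  shows "2 * x < y"
proof -
  have "(x - 2) * (2 * x) < (x - 2) * y"
    using assms by (simp add: algebra_simps)
  then show ?thesis using assms(1) by (simp add: mult_less_cancel_left)
qed

lemma realizable_1_x_y_if_pm1_mod:
  fixes x y m \<epsilon> v :: int
  assumes x: "2 < x" and y: "2 * x * x + 2 * x + 2 \<le> (x - 2) * y"
    and m: "5 + 2 * x + 2 * y \<le> m"
    and \<epsilon>: "\<epsilon> = 1 \<or> \<epsilon> = - 1" and v: "v = m * x * y + \<epsilon>"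
    and size: "v = int a + int b + int c + 1"
  shows "realizable v (replicate_mset a 1 + replicate_mset b x + replicate_mset c y)"
proof -
  have y_gt: "2 * x < y" using x y by (rule two_x_less_y)
  have m_pos: "0 < m" using m x y_gt by linarith
  \<comment> \<open>Here and in \<open>bound_y\<close> the inequality leaves a spare term,
    \<open>m * x\<close> or \<open>m * y\<close>, that absorbs \<open>\<epsilon> = - 1\<close> when
    \<open>v\<close> replaces \<open>m * x * y\<close>.\<close>
  have bound_x: "2 * (m * x * x) + m * x \<le> m * x * y"
  proof -
    have "m * x * (2 * x + 1) \<le> m * x * y"
      using y_gt m_pos x by (intro mult_left_mono) auto
    then show ?thesis by (simp only: distrib_left mult_1_right mult_ac)
  qed
  have bound_y: "3 * (m * y) \<le> m * x * y"
  proof -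
    have "m * y * 3 \<le> m * y * x"
      using y_gt m_pos x by (intro mult_left_mono) auto
    then show ?thesis by (simp only: mult_ac)
  qed
  have bound_xy: "2 * (m * x * x) + 2 * (m * x) + 2 * m \<le> m * x * y - 2 * (m * y)"
  proof -
    have "m * (2 * x * x + 2 * x + 2) \<le> m * ((x - 2) * y)"
      using y m_pos by (intro mult_left_mono) auto
    then show ?thesis by (simp only: distrib_left left_diff_distrib right_diff_distrib mult_ac)
  qed
  have "x \<le> m * x" "m \<le> m * x" "y \<le> m * y" "m * x \<le> m * x * x"
    using m_pos x y_gt by simp_all
  moreover have "- 1 \<le> \<epsilon>" "\<epsilon> \<le> 1" using \<epsilon> by auto
  ultimately have small: "2 * x \<le> v" "2 * y \<le> v" "2 * (m * x) \<le> v" "2 * (m * x * x) \<le> v" "2 * (m * y) \<le> v"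
    using bound_x bound_y m_pos x y_gt m unfolding v by linarith+
  have v_pos: "0 < v" using small x by linarith
  \<comment> \<open>Modulo \<open>v\<close> the product \<open>m * x * y\<close> is
    \<open>- \<epsilon>\<close>. So, up to sign, \<open>m * x\<close> is inverse to \<open>y\<close>
    and \<open>m * y\<close> is inverse to \<open>x\<close>.\<close>
  have unit: "cyc_len v (m * x * y * k) = cyc_len v k" for k
  proof (rule cyc_len_cong_pm[OF v_pos])
    have "[m * x * y = - \<epsilon>] (mod v)" by (simp add: cong_iff_dvd_diff v)
    then have "[m * x * y * k = - \<epsilon> * k] (mod v)" by (rule cong_scalar_right)
    with \<epsilon> show "[m * x * y * k = k] (mod v) \<or> [m * x * y * k = - k] (mod v)" by auto
  qed
  \<comment> \<open>A common divisor of \<open>m * x * y\<close> and \<open>v\<close> divides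
    \<open>\<epsilon>\<close>. This is used for the multipliers \<open>x\<close> and
    \<open>y\<close>.\<close>
  have cop: "coprime d v" if "d dvd m * x * y" for d
  proof (rule coprimeI)
    fix l assume "l dvd d" "l dvd v"
    then have "l dvd v - m * x * y" using that by (meson dvd_diff dvd_trans)
    then show "is_unit l" using \<epsilon> by (auto simp: v)
  qed
  have cyc_id: "cyc_len v 1 = 1" "cyc_len v x = x" "cyc_len v y = y"
    using small x y_gt by (auto intro!: cyc_len_small)
  consider "x + y + 1 \<le> int a" | "m * x + m * x * x + 1 \<le> int c"
    | "int a \<le> x + y" "int c \<le> m * x + m * x * x"
    by linarith
  then show ?thesis
  proof cases
    case 1
    then show ?thesis using small x y_gt size by (intro realizable_1_x_y) auto
  next
    case 2
    have "realizable v (replicate_mset c 1 + replicate_mset a (m * x) + replicate_mset b (m * x * x))"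
      using 2 small x m_pos size by (intro realizable_1_x_y) auto
    \<comment> \<open>Multiplication by \<open>y\<close> turns the lengths \<open>1\<close>,
      \<open>m * x\<close>, \<open>m * x * x\<close> into \<open>y\<close>, \<open>1\<close>,
      \<open>x\<close>.\<close>
    then have "realizable v (replicate_mset c y + replicate_mset a 1 + replicate_mset b x)"
    proof (rule realizable_multiply_1_x_y)
      show "cyc_len v (y * (m * x)) = 1" using unit[of 1] cyc_id by (simp add: mult_ac)
      show "cyc_len v (y * (m * x * x)) = x" using unit[of x] cyc_id by (simp add: mult_ac)
    qed (use v_pos cop cyc_id in auto)
    then show ?thesis by (simp add: add_ac)
  next
    case 3
    \<comment> \<open>Since \<open>y > 2 * x\<close>, the number \<open>m * y * y\<close> exceeds
      \<open>v\<close> and, unlike \<open>m * x * x\<close>, must be reduced to a length. Multiplied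
      by \<open>x\<close> it becomes \<open>y\<close> up to sign.\<close>
    define z where "z = cyc_len v (m * y * y)"
    have z: "0 \<le> z" "2 * z \<le> v" "[z = m * y * y] (mod v) \<or> [z = - (m * y * y)] (mod v)"
      unfolding z_def by (rule cyc_len_bounds[OF v_pos])+
    have "cyc_len v (x * z) = cyc_len v (m * x * y * y)"
    proof (rule cyc_len_cong_pm[OF v_pos])
      have "[x * z = x * (m * y * y)] (mod v) \<or> [x * z = x * - (m * y * y)] (mod v)"
        using z(3) by (metis cong_scalar_left)
      then show "[x * z = m * x * y * y] (mod v) \<or> [x * z = - (m * x * y * y)] (mod v)"
        by (simp add: mult_ac)
    qed
    then have xz: "cyc_len v (x * z) = y" using unit cyc_id by simp
    then have "z \<noteq> 0" using y_gt x cyc_len_small[of 0 v] v_pos by auto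
    \<comment> \<open>Doubled, and with \<open>2 * z \<le> v\<close> and the bounds on
      \<open>a\<close> and \<open>c\<close>, this needs \<open>v\<close> to be at least
      \<open>2 * m * y + 2 * m * x * x + 2 * m * x + 2 * x + 2 * y + 4\<close>. The spare
      \<open>2 * m\<close> in \<open>bound_xy\<close> covers the last three terms and
      \<open>\<epsilon> = - 1\<close>.\<close>
    moreover have "m * y + z + 1 \<le> int b"
      using bound_xy z(2) 3 size m v \<epsilon> by linarith
    ultimately have "realizable v (replicate_mset b 1 + replicate_mset a (m * y) + replicate_mset c z)"
      using z small y_gt x m_pos size by (intro realizable_1_x_y) auto
    then have "realizable v (replicate_mset b x + replicate_mset a 1 + replicate_mset c y)"
    proof (rule realizable_multiply_1_x_y)
      show "cyc_len v (x * (m * y)) = 1" using unit[of 1] cyc_id by (simp add: mult_ac)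
    qed (use v_pos cop cyc_id xz in auto)
    then show ?thesis by (simp add: add_ac)
  qed
qed

theorem theorem5p4:
  fixes x y :: int
  assumes "x > 2"
    and "real_of_int y > (2 * real_of_int x ^ 2 + 2 * real_of_int x + 1) / (real_of_int x - 2)"
  shows "\<exists>V :: int. \<forall>v :: int. v \<ge> V \<longrightarrow> [v = 1] (mod (x * y)) \<or> [v = - 1] (mod (x * y)) \<longrightarrow>
           (\<forall>L :: int multiset. int (size L) = v - 1 \<and> set_mset L = {1, x, y} \<longrightarrow> realizable v L)"
proof (intro exI allI impI)
  fix v :: int and L :: "int multiset"
  \<comment> \<open>This threshold is the witness for \<open>V\<close>: with
    \<open>v = m * x * y + \<epsilon>\<close> it forces
    \<open>m \<ge> 5 + 2 * x + 2 * y\<close>.\<close>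
  assume V: "v \<ge> x * y * (5 + 2 * x + 2 * y) + 1"
    and v: "[v = 1] (mod (x * y)) \<or> [v = - 1] (mod (x * y))"
    and L: "int (size L) = v - 1 \<and> set_mset L = {1, x, y}"
  have "2 * real_of_int x ^ 2 + 2 * real_of_int x + 1 < real_of_int y * (real_of_int x - 2)"
    using assms by (simp add: pos_divide_less_eq)
  then have "real_of_int (2 * x ^ 2 + 2 * x + 1) < real_of_int (y * (x - 2))" by simp
  then have "2 * x ^ 2 + 2 * x + 1 < y * (x - 2)" by (simp only: of_int_less_iff)
  \<comment> \<open>Strictness between integers raises the constant 1 to 2.\<close>
  then have y: "2 * x * x + 2 * x + 2 \<le> (x - 2) * y" by (simp add: power2_eq_square algebra_simps)
  have y_gt: "x < y" using two_x_less_y[OF assms(1) y] assms(1) by simp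
  obtain \<epsilon> m where \<epsilon>: "\<epsilon> = 1 \<or> \<epsilon> = - 1" and m: "v = m * x * y + \<epsilon>"
    using v unfolding cong_iff_dvd_diff dvd_def by (metis diff_eq_eq mult.assoc mult.commute)
  have "5 + 2 * x + 2 * y \<le> m"
  proof (rule ccontr)
    assume "\<not> ?thesis"
    then have "x * y * (m + 1) \<le> x * y * (5 + 2 * x + 2 * y)"
      using assms(1) y_gt by (intro mult_left_mono) auto
    moreover have "x * y > 0" using assms(1) y_gt by simp
    ultimately show False using V m \<epsilon> by (auto simp: algebra_simps)
  qed
  \<comment> \<open>As \<open>1 < x < y\<close>, the three blocks have distinct values and their
    counts do not mix.\<close>
  have L_eq: "L = replicate_mset (count L 1) 1 + replicate_mset (count L x) x + replicate_mset (count L y) y"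
  proof (rule multiset_eqI)
    fix z
    have "count L z = 0" if "z \<notin> {1, x, y}" using that L by (metis count_inI)
    then show "count L z = count (replicate_mset (count L 1) 1 + replicate_mset (count L x) x +
        replicate_mset (count L y) y) z"
      using assms(1) y_gt by auto
  qed
  then have "size L = count L 1 + count L x + count L y"
    by (metis size_replicate_mset size_union)
  then have "v = int (count L 1) + int (count L x) + int (count L y) + 1" using L by simp
  then have "realizable v (replicate_mset (count L 1) 1 + replicate_mset (count L x) x +
      replicate_mset (count L y) y)"
    by (intro realizable_1_x_y_if_pm1_mod[OF assms(1) y \<open>5 + 2 * x + 2 * y \<le> m\<close> \<epsilon> m])
  then show "realizable v L" unfolding L_eq[symmetric] .
qed

end
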